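(* Let $\Psi(a,b)=\left(a+\frac b2,\frac{\sqrt3 b}{2}\right)$ (so $(a,b)$ are the $\Psi$-coordinates of the point $\Psi(a,b)$). Let $T$ be an equilateral triangle with two of its sides parallel to $\Psi(1,0)$ and $\Psi(0,1)$ (so $T$ has vertices $\Psi(A,B),\Psi(A+C,B),\Psi(A,B+C)$ for some reals $A,B$ and $C\neq 0$), tiled by equilateral triangles. Suppose that (1) the horizontal side and the opposite vertex of $T$ have integer second $\Psi$-coordinates (i.e. $B,B+C\in\mathbb{Z}$); (2) no vertex of any triangular tile has a $\Psi$-coordinate with fractional part $\frac12$; (3) for each triangular tile, the number of $\frac12$-shifted $60^\circ$ diagonal grid lines through it equals the number of $\frac12$-shifted horizontal grid lines through it. Then each triangular tile has side length equal to the number of $\frac12$-shifted $60^\circ$ diagonal grid lines through it. In particular, all tiles have integer side length.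
   Context: The $\frac12$-shifted $60^\circ$ diagonal grid lines are the lines $\Psi(\{k+\frac12\}\times\mathbb{R})$, $k\in\mathbb{Z}$, and the $\frac12$-shifted horizontal grid lines (in this setting) are the lines $\Psi(\mathbb{R}\times\{k+\frac12\})$, $k\in\mathbb{Z}$. A tiling of a region means a finite family of closed tiles with pairwise disjoint interiors whose union is the region. *)

theory Defs
  imports "HOL-Analysis.Analysis"
begin

definition Psi :: "real \<times> real \<Rightarrow> real \<times> real" where
  "Psi = (\<lambda>(a, b). (a + b / 2, sqrt 3 * b / 2))"

text \<open>A (nondegenerate, closed) equilateral triangle \<open>S\<close> with vertex set \<open>V\<close> and side length
  \<open>s\<close>, in arbitrary position and orientation. The distance on \<open>real \<times> real\<close> is Euclidean.\<close>

definition equilateral_triangle ::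
  "(real \<times> real) set \<Rightarrow> real \<Rightarrow> (real \<times> real) set \<Rightarrow> bool" where
  "equilateral_triangle V s S \<longleftrightarrow>
     card V = 3 \<and> s > 0 \<and> (\<forall>u\<in>V. \<forall>v\<in>V. u \<noteq> v \<longrightarrow> dist u v = s) \<and> S = convex hull V"

definition tiling :: "(real \<times> real) set \<Rightarrow> (real \<times> real) set set \<Rightarrow> bool" where
  "tiling R \<D> \<longleftrightarrow>
     finite \<D> \<and> (\<forall>S\<in>\<D>. closed S) \<and>
     pairwise (\<lambda>S S'. interior S \<inter> interior S' = {}) \<D> \<and> \<Union>\<D> = R"

definition shifted_diagonal_lines :: "(real \<times> real) set set" where
  "shifted_diagonal_lines = range (\<lambda>k::int. Psi ` ({of_int k + 1/2} \<times> UNIV))"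

definition shifted_horizontal_lines :: "(real \<times> real) set set" where
  "shifted_horizontal_lines = range (\<lambda>k::int. Psi ` (UNIV \<times> {of_int k + 1/2}))"

text \<open>A line passes through a closed tile if it meets it. For a triangle none of whose vertices
  lies on a line of the family, this is the same as meeting its interior.\<close>

definition num_lines_through ::
  "(real \<times> real) set set \<Rightarrow> (real \<times> real) set \<Rightarrow> nat" where
  "num_lines_through \<L> S = card {L \<in> \<L>. L \<inter> S \<noteq> {}}"

end

theory Submission
  imports Defs
begin

text \<open>Attach to a triangle with corners \<open>p0\<close>, \<open>p1 = p0 + c u\<close>, \<open>p2 = p0 + c v\<close> (with \<open>c\<close> of either
  sign) the point charge \<open>[p0] - [p1]\<close>, and likewise \<open>[p0] - [p2]\<close>. Such a charge is a mixed second
  difference of the indicator function of the triangle at a point, which vanishes for triangles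
  without a side parallel to \<open>u\<close>. Hence charges are additive over tilings, and for all functions \<open>f\<close>
  the sums of \<open>f p1 - f p0\<close> and of \<open>f p2 - f p0\<close> over the tiles with sides parallel to \<open>u\<close> equal the
  corresponding terms of the big triangle \<open>T\<close>.

  Let a tile have corners \<open>(a, b)\<close>, \<open>(a + c, b)\<close>, \<open>(a, b + c)\<close> in \<open>\<Psi>\<close>-coordinates, and let \<open>r x\<close> be the
  displacement from \<open>x\<close> to its nearest integer. By (3),
  \<open>d = r (a + c) - r a = r (b + c) - r b\<close>, and this is the signed number of lines minus \<open>c\<close>. The sum of
  \<open>d\<^sup>2 = (r (a + c))\<^sup>2 - (r a)\<^sup>2 - 2 r a (r (b + c) - r b)\<close> over all tiles is a sum of edge terms, so it
  equals the corresponding expression for \<open>T\<close>, which is \<open>0\<close> by (1). The same identity with the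
  identity function in place of \<open>r\<close> shows that all tiles are aligned with \<open>T\<close>.\<close>

section \<open>Determinants and triangles in oblique coordinates\<close>

definition cross2 :: "real \<times> real \<Rightarrow> real \<times> real \<Rightarrow> real" where
  "cross2 x y = fst x * snd y - snd x * fst y"

definition rot60 :: "real \<times> real \<Rightarrow> real \<times> real" where
  "rot60 x = (fst x / 2 - sqrt 3 / 2 * snd x, sqrt 3 / 2 * fst x + snd x / 2)"

text \<open>The numbers \<open>a\<close>, \<open>b\<close>, \<open>c\<close> are coordinates in the
  basis \<open>u\<close>, \<open>v\<close>. A negative \<open>c\<close> gives the triangles pointing
  the other way, so one formula serves both orientations.\<close>

definition tri_vertices ::
  "real \<times> real \<Rightarrow> real \<times> real \<Rightarrow> real \<Rightarrow> real \<Rightarrow> real \<Rightarrow> (real \<times> real) set" where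
  "tri_vertices u v a b c =
     {a *\<^sub>R u + b *\<^sub>R v, (a + c) *\<^sub>R u + b *\<^sub>R v, a *\<^sub>R u + (b + c) *\<^sub>R v}"

definition tri :: "real \<times> real \<Rightarrow> real \<times> real \<Rightarrow> real \<Rightarrow> real \<Rightarrow> real \<Rightarrow> (real \<times> real) set" where
  "tri u v a b c = convex hull tri_vertices u v a b c"

lemma tri_swap: "tri v u b a c = tri u v a b c"
  unfolding tri_def tri_vertices_def by (simp add: add.commute insert_commute)

text \<open>Cramer's rule.\<close>

lemma cross2_basis:
  assumes "cross2 u v \<noteq> 0"
  obtains x y where "P = x *\<^sub>R u + y *\<^sub>R v"
proof
  show "P = (cross2 P v / cross2 u v) *\<^sub>R u + (cross2 u P / cross2 u v) *\<^sub>R v"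
    using assms by (simp add: prod_eq_iff cross2_def divide_simps) (simp add: algebra_simps)
qed

lemma cross2_coords_eq_iff:
  assumes "cross2 u v \<noteq> 0"
  shows "x *\<^sub>R u + y *\<^sub>R v = x' *\<^sub>R u + y' *\<^sub>R v \<longleftrightarrow> x = x' \<and> y = y'"
proof
  assume eq: "x *\<^sub>R u + y *\<^sub>R v = x' *\<^sub>R u + y' *\<^sub>R v"
  have "cross2 (x *\<^sub>R u + y *\<^sub>R v) v = x * cross2 u v" for x y
    by (simp add: cross2_def algebra_simps)
  moreover have "cross2 u (x *\<^sub>R u + y *\<^sub>R v) = y * cross2 u v" for x y
    by (simp add: cross2_def algebra_simps)
  ultimately show "x = x' \<and> y = y'"
    using eq assms by (metis mult_right_cancel)
qed simp

text \<open>The barycentric weights of the second and third corners are \<open>(x - a) / c\<close>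
  and \<open>(y - b) / c\<close>. Multiplying by \<open>c\<close> instead of dividing keeps one form
  of the inequalities for both signs of \<open>c\<close>.\<close>

lemma mem_tri_iff:
  assumes "cross2 u v \<noteq> 0" and "c \<noteq> 0"
  shows "x *\<^sub>R u + y *\<^sub>R v \<in> tri u v a b c \<longleftrightarrow>
    0 \<le> (x - a) * c \<and> 0 \<le> (y - b) * c \<and> 0 \<le> (a + b + c - x - y) * c"
proof -
  have "x *\<^sub>R u + y *\<^sub>R v \<in> tri u v a b c \<longleftrightarrow>
     (\<exists>\<alpha> \<beta> \<gamma>. 0 \<le> \<alpha> \<and> 0 \<le> \<beta> \<and> 0 \<le> \<gamma> \<and> \<alpha> + \<beta> + \<gamma> = 1 \<and>
        x *\<^sub>R u + y *\<^sub>R v = \<alpha> *\<^sub>R (a *\<^sub>R u + b *\<^sub>R v)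
          + \<beta> *\<^sub>R ((a + c) *\<^sub>R u + b *\<^sub>R v) + \<gamma> *\<^sub>R (a *\<^sub>R u + (b + c) *\<^sub>R v))"
    unfolding tri_def tri_vertices_def convex_hull_3 by blast
  also have "\<dots> \<longleftrightarrow>
     (\<exists>\<alpha> \<beta> \<gamma>. 0 \<le> \<alpha> \<and> 0 \<le> \<beta> \<and> 0 \<le> \<gamma> \<and> \<alpha> + \<beta> + \<gamma> = 1 \<and> x = a + \<beta> * c \<and> y = b + \<gamma> * c)"
  proof -
    have "\<alpha> *\<^sub>R (a *\<^sub>R u + b *\<^sub>R v) + \<beta> *\<^sub>R ((a + c) *\<^sub>R u + b *\<^sub>R v) + \<gamma> *\<^sub>R (a *\<^sub>R u + (b + c) *\<^sub>R v)
      = (a + \<beta> * c) *\<^sub>R u + (b + \<gamma> * c) *\<^sub>R v" if "\<alpha> + \<beta> + \<gamma> = 1" for \<alpha> \<beta> \<gamma> :: real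
    proof -
      have "\<alpha> = 1 - \<beta> - \<gamma>" using that by simp
      show ?thesis unfolding \<open>\<alpha> = 1 - \<beta> - \<gamma>\<close> by (simp add: algebra_simps)
    qed
    then show ?thesis
      using cross2_coords_eq_iff[OF assms(1)] by (smt (verit, best))
  qed
  also have "\<dots> \<longleftrightarrow> 0 \<le> (x - a) / c \<and> 0 \<le> (y - b) / c \<and> 0 \<le> 1 - (x - a) / c - (y - b) / c"
  proof
    assume "0 \<le> (x - a) / c \<and> 0 \<le> (y - b) / c \<and> 0 \<le> 1 - (x - a) / c - (y - b) / c"
    then show "\<exists>\<alpha> \<beta> \<gamma>. 0 \<le> \<alpha> \<and> 0 \<le> \<beta> \<and> 0 \<le> \<gamma> \<and> \<alpha> + \<beta> + \<gamma> = 1 \<and> x = a + \<beta> * c \<and> y = b + \<gamma> * c"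
      using assms(2) by (intro exI[of _ "1 - (x - a) / c - (y - b) / c"] exI[of _ "(x - a) / c"]
          exI[of _ "(y - b) / c"]) auto
  qed (use assms(2) in auto)
  also have "1 - (x - a) / c - (y - b) / c = (a + b + c - x - y) / c"
    using assms(2) by (simp add: field_simps)
  finally show ?thesis
    by (simp add: zero_le_divide_iff zero_le_mult_iff)
qed

section \<open>Half-planes and sums of indicator functions\<close>

text \<open>For nonzero \<open>d\<close>, a pair \<open>(d, q)\<close> encodes the closed half-plane
  to the left of the line through \<open>q\<close> with direction \<open>d\<close>.\<close>

definition polygon :: "((real \<times> real) \<times> (real \<times> real)) set \<Rightarrow> (real \<times> real) set" where
  "polygon H = {X. \<forall>(d, q)\<in>H. 0 \<le> cross2 d (X - q)}"

text \<open>The factor \<open>k\<close> carries the sign of \<open>c\<close> and the orientation of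
  the basis, so every side is directed with the triangle on its left. Each half-plane test is then
  an inequality of \<open>mem_tri_iff\<close> times the positive number
  \<open>(cross2 u v)\<^sup>2\<close>.\<close>

lemma tri_eq_polygon:
  fixes u v :: "real \<times> real"
  assumes "cross2 u v \<noteq> 0" and "c \<noteq> 0"
  defines "k \<equiv> c * cross2 u v"
  shows "tri u v a b c = polygon {(k *\<^sub>R u, a *\<^sub>R u + b *\<^sub>R v), (k *\<^sub>R (v - u), (a + c) *\<^sub>R u + b *\<^sub>R v),
     (- k *\<^sub>R v, a *\<^sub>R u + b *\<^sub>R v)}" (is "_ = ?H")
proof (rule set_eqI)
  fix X
  obtain x y where X: "X = x *\<^sub>R u + y *\<^sub>R v" using cross2_basis[OF assms(1)] .
  have 1: "cross2 (k *\<^sub>R u) (X - (a *\<^sub>R u + b *\<^sub>R v)) = (cross2 u v)\<^sup>2 * ((y - b) * c)"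
    by (simp add: X k_def cross2_def power2_eq_square algebra_simps)
  have 2: "cross2 (k *\<^sub>R (v - u)) (X - ((a + c) *\<^sub>R u + b *\<^sub>R v))
      = (cross2 u v)\<^sup>2 * ((a + b + c - x - y) * c)"
    by (simp add: X k_def cross2_def power2_eq_square algebra_simps)
  have 3: "cross2 (- k *\<^sub>R v) (X - (a *\<^sub>R u + b *\<^sub>R v)) = (cross2 u v)\<^sup>2 * ((x - a) * c)"
    by (simp add: X k_def cross2_def power2_eq_square algebra_simps)
  have "0 < (cross2 u v)\<^sup>2" using assms(1) by simp
  then have "0 \<le> (cross2 u v)\<^sup>2 * t \<longleftrightarrow> 0 \<le> t" for t
    by (simp add: zero_le_mult_iff)
  then have "X \<in> ?H \<longleftrightarrow> 0 \<le> (x - a) * c \<and> 0 \<le> (y - b) * c \<and> 0 \<le> (a + b + c - x - y) * c"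
    unfolding polygon_def using 1 2 3 by auto
  then show "X \<in> tri u v a b c \<longleftrightarrow> X \<in> ?H"
    using mem_tri_iff[OF assms(1,2)] X by simp
qed

text \<open>Off the boundary lines all inequalities are strict, and finitely many strict ones cut
  out an open set.\<close>

lemma polygon_generic_interior:
  assumes "finite H" "X \<in> polygon H" "\<forall>(d, q)\<in>H. cross2 d (X - q) \<noteq> 0"
  shows "X \<in> interior (polygon H)"
proof (rule interiorI)
  have "open {X. 0 < cross2 (fst h) (X - snd h)}" for h
    unfolding cross2_def by (intro open_Collect_less continuous_intros)
  then show "open (\<Inter>h\<in>H. {X. 0 < cross2 (fst h) (X - snd h)})"
    using assms(1) by (intro open_INT) auto
  show "X \<in> (\<Inter>h\<in>H. {X. 0 < cross2 (fst h) (X - snd h)})"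
    using assms(2,3) unfolding polygon_def by (force simp: order_less_le)
  show "(\<Inter>h\<in>H. {X. 0 < cross2 (fst h) (X - snd h)}) \<subseteq> polygon H"
    unfolding polygon_def by (force simp: less_imp_le)
qed

text \<open>A point off all side lines lies in the interior of every tile that contains it.
  Interiors are disjoint, so there is at most one such tile.\<close>

lemma tiling_sum_indicator:
  assumes til: "tiling T \<D>"
    and poly: "\<And>S. S \<in> \<D> \<Longrightarrow> finite (H S) \<and> S = polygon (H S)"
    and gen: "\<forall>S\<in>\<D>. \<forall>(d, q)\<in>H S. cross2 d (X - q) \<noteq> 0"
  shows "(\<Sum>S\<in>\<D>. indicator S X) = (indicator T X :: real)"
proof (cases "X \<in> T")
  case True
  have fin: "finite \<D>" and T: "\<Union>\<D> = T" using til by (auto simp: tiling_def)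
  obtain S0 where S0: "S0 \<in> \<D>" "X \<in> S0" using True T by auto
  have int: "X \<in> interior S" if "S \<in> \<D>" "X \<in> S" for S
    using polygon_generic_interior[of "H S" X] poly[OF that(1)] gen that by auto
  have "X \<notin> S" if "S \<in> \<D>" "S \<noteq> S0" for S
    using til int[OF S0] int[of S] that S0(1) unfolding tiling_def pairwise_def by blast
  then have "(\<Sum>S\<in>\<D>. indicator S X) = (\<Sum>S\<in>{S0}. indicator S X :: real)"
    using S0 fin by (intro sum.mono_neutral_right) auto
  then show ?thesis using S0 True by simp
next
  case False
  then have "X \<notin> S" if "S \<in> \<D>" for S using til that by (auto simp: tiling_def)
  then show ?thesis using False by simp
qed

section \<open>Iterated one-sided limits\<close>

text \<open>The iterated limit: \<open>\<epsilon>\<close> is small depending on \<open>\<delta>\<close>.\<close>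

definition ev2 :: "(real \<Rightarrow> real \<Rightarrow> bool) \<Rightarrow> bool" where
  "ev2 Q \<longleftrightarrow> (\<forall>\<^sub>F \<delta> in at_right 0. \<forall>\<^sub>F \<epsilon> in at_right 0. Q \<delta> \<epsilon>)"

lemma ev2_conj: "ev2 Q \<Longrightarrow> ev2 Q' \<Longrightarrow> ev2 (\<lambda>\<delta> \<epsilon>. Q \<delta> \<epsilon> \<and> Q' \<delta> \<epsilon>)"
  unfolding ev2_def by (simp add: eventually_conj_iff)

lemma ev2_mono: "ev2 Q \<Longrightarrow> (\<And>\<delta> \<epsilon>. Q \<delta> \<epsilon> \<Longrightarrow> Q' \<delta> \<epsilon>) \<Longrightarrow> ev2 Q'"
  unfolding ev2_def by (auto elim!: eventually_mono)

lemma ev2_ball: "finite A \<Longrightarrow> (\<And>x. x \<in> A \<Longrightarrow> ev2 (Q x)) \<Longrightarrow> ev2 (\<lambda>\<delta> \<epsilon>. \<forall>x\<in>A. Q x \<delta> \<epsilon>)"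
  unfolding ev2_def by (simp add: eventually_ball_finite_distrib)

lemma ev2_const: "ev2 (\<lambda>\<delta> \<epsilon>. Q) \<Longrightarrow> Q"
  unfolding ev2_def by simp

lemma eventually_at_right_bounded: "m \<noteq> 0 \<Longrightarrow> \<forall>\<^sub>F \<epsilon> in at_right 0. 0 < \<epsilon> \<and> \<epsilon> * \<bar>k\<bar> < \<bar>m\<bar>" for k m :: real
proof -
  assume "m \<noteq> 0"
  \<comment> \<open>The summand \<open>1\<close> keeps the denominator positive when
    \<open>k = 0\<close>.\<close>
  then have "\<forall>\<^sub>F \<epsilon> in at_right 0. \<epsilon> < \<bar>m\<bar> / (\<bar>k\<bar> + 1)"
    by (intro eventually_at_right_less order_tendstoD(2)[OF tendsto_ident_at]) auto
  moreover have "\<forall>\<^sub>F \<epsilon> in at_right (0::real). 0 < \<epsilon>" by (rule eventually_at_right_less)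
  ultimately show ?thesis
  proof eventually_elim
    case (elim \<epsilon>)
    then have "\<epsilon> * (\<bar>k\<bar> + 1) < \<bar>m\<bar>" by (simp add: pos_less_divide_eq add_pos_nonneg)
    then show ?case using elim by (simp add: algebra_simps)
  qed
qed

text \<open>Since \<open>k1\<close> is nonzero, \<open>k0 + \<delta> * k1\<close> and
  \<open>k0 - \<delta> * k1\<close> are nonzero for small \<open>\<delta>\<close>. A much smaller
  \<open>\<epsilon>\<close> then cannot change their signs through a term
  \<open>\<epsilon> * k2\<close>.\<close>

lemma ev2_bounds:
  fixes k0 k1 k2 :: real
  assumes "k1 \<noteq> 0"
  shows "ev2 (\<lambda>\<delta> \<epsilon>. 0 < \<epsilon> \<and> \<epsilon> * \<bar>k2\<bar> < \<bar>k0 + \<delta> * k1\<bar> \<and> \<epsilon> * \<bar>k2\<bar> < \<bar>k0 - \<delta> * k1\<bar>)"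
proof -
  have "\<forall>\<^sub>F \<delta> in at_right 0. k0 + \<delta> * k1 \<noteq> 0 \<and> k0 - \<delta> * k1 \<noteq> 0"
  proof (cases "k0 = 0")
    case True
    show ?thesis using eventually_at_right_less[of "0::real"]
      by eventually_elim (use True assms in auto)
  next
    case False
    from eventually_at_right_bounded[OF this, of k1] show ?thesis
    proof eventually_elim
      case (elim \<delta>)
      then have "\<bar>\<delta> * k1\<bar> < \<bar>k0\<bar>" by (simp add: abs_mult)
      then show ?case by linarith
    qed
  qed
  then show ?thesis unfolding ev2_def
  proof eventually_elim
    case (elim \<delta>)
    show ?case using eventually_at_right_bounded[of "k0 + \<delta> * k1" k2] eventually_at_right_bounded[of "k0 - \<delta> * k1" k2] elim
      by (auto simp: eventually_conj_iff)
  qed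
qed

text \<open>The four expressions are the values of an affine function at the four sample points of
  \<open>corner_jump\<close>. A function that is not constant eventually avoids zero there.\<close>

lemma ev2_nonzero:
  fixes k0 k1 k2 :: real
  assumes "k1 \<noteq> 0 \<or> k2 \<noteq> 0"
  shows "ev2 (\<lambda>\<delta> \<epsilon>. k0 + \<delta> * k1 + \<epsilon> * k2 \<noteq> 0 \<and> k0 + \<delta> * k1 - \<epsilon> * k2 \<noteq> 0 \<and>
    k0 - \<delta> * k1 + \<epsilon> * k2 \<noteq> 0 \<and> k0 - \<delta> * k1 - \<epsilon> * k2 \<noteq> 0)"
proof (cases "k1 = 0")
  case False
  have *: "m + \<epsilon> * k2 \<noteq> 0 \<and> m - \<epsilon> * k2 \<noteq> 0" if "0 < \<epsilon>" "\<epsilon> * \<bar>k2\<bar> < \<bar>m\<bar>" for m \<epsilon>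
  proof -
    have "\<bar>\<epsilon> * k2\<bar> < \<bar>m\<bar>" using that by (simp add: abs_mult)
    then show ?thesis by linarith
  qed
  show ?thesis using ev2_bounds[OF False, of k2 k0] by (rule ev2_mono) (use * in blast)
next
  case True
  then have k2: "k2 \<noteq> 0" using assms by simp
  have "\<forall>\<^sub>F \<epsilon> in at_right 0. k0 + \<epsilon> * k2 \<noteq> 0 \<and> k0 - \<epsilon> * k2 \<noteq> 0"
  proof (cases "k0 = 0")
    case True
    show ?thesis using eventually_at_right_less[of "0::real"]
      by eventually_elim (use True k2 in auto)
  next
    case False
    from eventually_at_right_bounded[OF this, of k2] show ?thesis
    proof eventually_elim
      case (elim \<epsilon>)
      then have "\<bar>\<epsilon> * k2\<bar> < \<bar>k0\<bar>" by (simp add: abs_mult)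
      then show ?case by linarith
    qed
  qed
  then show ?thesis using True by (simp add: ev2_def) (auto elim: eventually_mono)
qed

section \<open>Point charges and their additivity\<close>

definition corner_jump ::
  "real \<times> real \<Rightarrow> real \<times> real \<Rightarrow> real \<times> real \<Rightarrow> real \<Rightarrow> real \<Rightarrow> (real \<times> real) set \<Rightarrow> real" where
  "corner_jump u v P \<delta> \<epsilon> S =
     indicator S (P + \<delta> *\<^sub>R u + \<epsilon> *\<^sub>R v) - indicator S (P + \<delta> *\<^sub>R u - \<epsilon> *\<^sub>R v)
     - indicator S (P - \<delta> *\<^sub>R u + \<epsilon> *\<^sub>R v) + indicator S (P - \<delta> *\<^sub>R u - \<epsilon> *\<^sub>R v)"

text \<open>For fixed \<open>\<delta>\<close> the two \<open>\<epsilon>\<close>-differences detect whether a side parallel to \<open>u\<close> runs just after,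
  respectively just before, \<open>P\<close>; so the limit is nonzero only at the endpoints of such a side.\<close>

definition has_charge ::
  "real \<times> real \<Rightarrow> real \<times> real \<Rightarrow> (real \<times> real) set \<Rightarrow> (real \<times> real \<Rightarrow> real) \<Rightarrow> bool" where
  "has_charge u v S \<kappa> \<longleftrightarrow> (\<forall>P. ev2 (\<lambda>\<delta> \<epsilon>. corner_jump u v P \<delta> \<epsilon> S = \<kappa> P))"

lemma cross2_offsets:
  "cross2 d (P + \<delta> *\<^sub>R u + \<epsilon> *\<^sub>R v - q) = cross2 d (P - q) + \<delta> * cross2 d u + \<epsilon> * cross2 d v"
  "cross2 d (P + \<delta> *\<^sub>R u - \<epsilon> *\<^sub>R v - q) = cross2 d (P - q) + \<delta> * cross2 d u - \<epsilon> * cross2 d v"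
  "cross2 d (P - \<delta> *\<^sub>R u + \<epsilon> *\<^sub>R v - q) = cross2 d (P - q) - \<delta> * cross2 d u + \<epsilon> * cross2 d v"
  "cross2 d (P - \<delta> *\<^sub>R u - \<epsilon> *\<^sub>R v - q) = cross2 d (P - q) - \<delta> * cross2 d u - \<epsilon> * cross2 d v"
  by (simp_all add: cross2_def algebra_simps)

text \<open>Eventually the four sample points around \<open>P\<close> avoid all side lines of all
  tiles. There the indicator functions of the tiles add up to that of \<open>T\<close>, and
  \<open>corner_jump\<close> is linear in the indicator.\<close>

lemma tiling_sum_charge:
  assumes til: "tiling T \<D>" and uv: "cross2 u v \<noteq> 0"
    and poly: "\<And>S. S \<in> \<D> \<Longrightarrow> finite (H S) \<and> S = polygon (H S) \<and> (\<forall>(d, q)\<in>H S. d \<noteq> 0)"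
    and charge: "\<And>S. S \<in> \<D> \<Longrightarrow> has_charge u v S (\<kappa> S)" and chargeT: "has_charge u v T \<kappa>T"
  shows "(\<Sum>S\<in>\<D>. \<kappa> S P) = \<kappa>T P"
proof -
  have fin: "finite \<D>" using til by (simp add: tiling_def)
  \<comment> \<open>A nonzero direction cannot be parallel to both basis vectors.\<close>
  have nz: "cross2 d u \<noteq> 0 \<or> cross2 d v \<noteq> 0" if "d \<noteq> 0" for d
  proof (rule ccontr)
    assume "\<not> ?thesis"
    then have "fst d * cross2 u v = 0" "snd d * cross2 u v = 0"
      unfolding cross2_def by (auto simp: algebra_simps) (algebra, algebra)
    then show False using that uv by (simp add: prod_eq_iff)
  qed
  have "ev2 (\<lambda>\<delta> \<epsilon>. \<forall>S\<in>\<D>. \<forall>h\<in>H S. \<forall>X\<in>{P + \<delta> *\<^sub>R u + \<epsilon> *\<^sub>R v, P + \<delta> *\<^sub>R u - \<epsilon> *\<^sub>R v,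
      P - \<delta> *\<^sub>R u + \<epsilon> *\<^sub>R v, P - \<delta> *\<^sub>R u - \<epsilon> *\<^sub>R v}. cross2 (fst h) (X - snd h) \<noteq> 0)"
  proof (intro ev2_ball)
    fix S h assume S: "S \<in> \<D>" and h: "h \<in> H S"
    then have "fst h \<noteq> 0" using poly[OF S] by auto
    from ev2_nonzero[OF nz[OF this]]
    show "ev2 (\<lambda>\<delta> \<epsilon>. \<forall>X\<in>{P + \<delta> *\<^sub>R u + \<epsilon> *\<^sub>R v, P + \<delta> *\<^sub>R u - \<epsilon> *\<^sub>R v,
      P - \<delta> *\<^sub>R u + \<epsilon> *\<^sub>R v, P - \<delta> *\<^sub>R u - \<epsilon> *\<^sub>R v}. cross2 (fst h) (X - snd h) \<noteq> 0)"
      by (simp add: cross2_offsets)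
  qed (use fin poly in auto)
  moreover have "ev2 (\<lambda>\<delta> \<epsilon>. \<forall>S\<in>\<D>. corner_jump u v P \<delta> \<epsilon> S = \<kappa> S P)"
    using charge fin unfolding has_charge_def by (intro ev2_ball) blast+
  moreover have "ev2 (\<lambda>\<delta> \<epsilon>. corner_jump u v P \<delta> \<epsilon> T = \<kappa>T P)"
    using chargeT unfolding has_charge_def by blast
  ultimately have "ev2 (\<lambda>\<delta> \<epsilon>. (\<forall>S\<in>\<D>. \<forall>h\<in>H S. \<forall>X\<in>{P + \<delta> *\<^sub>R u + \<epsilon> *\<^sub>R v, P + \<delta> *\<^sub>R u - \<epsilon> *\<^sub>R v,
      P - \<delta> *\<^sub>R u + \<epsilon> *\<^sub>R v, P - \<delta> *\<^sub>R u - \<epsilon> *\<^sub>R v}. cross2 (fst h) (X - snd h) \<noteq> 0) \<and>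
      (\<forall>S\<in>\<D>. corner_jump u v P \<delta> \<epsilon> S = \<kappa> S P) \<and> corner_jump u v P \<delta> \<epsilon> T = \<kappa>T P)"
    by (intro ev2_conj)
  then have "ev2 (\<lambda>\<delta> \<epsilon>. (\<Sum>S\<in>\<D>. \<kappa> S P) = \<kappa>T P)"
  proof (rule ev2_mono, elim conjE)
    fix \<delta> \<epsilon>
    assume gen: "\<forall>S\<in>\<D>. \<forall>h\<in>H S. \<forall>X\<in>{P + \<delta> *\<^sub>R u + \<epsilon> *\<^sub>R v, P + \<delta> *\<^sub>R u - \<epsilon> *\<^sub>R v,
      P - \<delta> *\<^sub>R u + \<epsilon> *\<^sub>R v, P - \<delta> *\<^sub>R u - \<epsilon> *\<^sub>R v}. cross2 (fst h) (X - snd h) \<noteq> 0"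
      and \<kappa>: "\<forall>S\<in>\<D>. corner_jump u v P \<delta> \<epsilon> S = \<kappa> S P" "corner_jump u v P \<delta> \<epsilon> T = \<kappa>T P"
    have *: "(\<Sum>S\<in>\<D>. indicator S X) = (indicator T X :: real)"
      if "X \<in> {P + \<delta> *\<^sub>R u + \<epsilon> *\<^sub>R v, P + \<delta> *\<^sub>R u - \<epsilon> *\<^sub>R v,
        P - \<delta> *\<^sub>R u + \<epsilon> *\<^sub>R v, P - \<delta> *\<^sub>R u - \<epsilon> *\<^sub>R v}" for X
    proof (rule tiling_sum_indicator[OF til])
      show "\<forall>S\<in>\<D>. \<forall>(d, q)\<in>H S. cross2 d (X - q) \<noteq> 0"
        using gen that by fastforce
    qed (use poly in blast)
    have "(\<Sum>S\<in>\<D>. \<kappa> S P) = (\<Sum>S\<in>\<D>. corner_jump u v P \<delta> \<epsilon> S)"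
      using \<kappa> by simp
    also have "\<dots> = corner_jump u v P \<delta> \<epsilon> T"
      unfolding corner_jump_def by (simp add: sum.distrib sum_subtractf *)
    finally show "(\<Sum>S\<in>\<D>. \<kappa> S P) = \<kappa>T P" using \<kappa> by simp
  qed
  then show ?thesis by (rule ev2_const)
qed

text \<open>With no side line parallel to \<open>u\<close>, the shift by \<open>\<delta>\<close>
  along \<open>u\<close> leaves every side line, and the far smaller shift by
  \<open>\<epsilon>\<close> crosses none. Both \<open>\<epsilon>\<close>-differences therefore
  vanish.\<close>

lemma has_charge_polygon_zero:
  assumes "finite H" "\<And>d q. (d, q) \<in> H \<Longrightarrow> cross2 d u \<noteq> 0"
  shows "has_charge u v (polygon H) (\<lambda>_. 0)"
  unfolding has_charge_def
proof
  fix P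
  have "ev2 (\<lambda>\<delta> \<epsilon>. \<forall>h\<in>H. 0 < \<epsilon> \<and>
      \<epsilon> * \<bar>cross2 (fst h) v\<bar> < \<bar>cross2 (fst h) (P - snd h) + \<delta> * cross2 (fst h) u\<bar> \<and>
      \<epsilon> * \<bar>cross2 (fst h) v\<bar> < \<bar>cross2 (fst h) (P - snd h) - \<delta> * cross2 (fst h) u\<bar>)"
    using assms by (intro ev2_ball ev2_bounds) auto
  then show "ev2 (\<lambda>\<delta> \<epsilon>. corner_jump u v P \<delta> \<epsilon> (polygon H) = 0)"
  proof (rule ev2_mono)
    fix \<delta> \<epsilon>
    assume *: "\<forall>h\<in>H. 0 < \<epsilon> \<and>
      \<epsilon> * \<bar>cross2 (fst h) v\<bar> < \<bar>cross2 (fst h) (P - snd h) + \<delta> * cross2 (fst h) u\<bar> \<and>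
      \<epsilon> * \<bar>cross2 (fst h) v\<bar> < \<bar>cross2 (fst h) (P - snd h) - \<delta> * cross2 (fst h) u\<bar>"
    have aux: "0 \<le> m + \<epsilon> * k \<longleftrightarrow> 0 \<le> m - \<epsilon> * k" if "0 < \<epsilon>" "\<epsilon> * \<bar>k\<bar> < \<bar>m\<bar>" for m k
    proof -
      have "\<bar>\<epsilon> * k\<bar> < \<bar>m\<bar>" using that by (simp add: abs_mult)
      then show ?thesis by linarith
    qed
    have "P + \<delta> *\<^sub>R u + \<epsilon> *\<^sub>R v \<in> polygon H \<longleftrightarrow> P + \<delta> *\<^sub>R u - \<epsilon> *\<^sub>R v \<in> polygon H"
      "P - \<delta> *\<^sub>R u + \<epsilon> *\<^sub>R v \<in> polygon H \<longleftrightarrow> P - \<delta> *\<^sub>R u - \<epsilon> *\<^sub>R v \<in> polygon H"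
      using * aux unfolding polygon_def cross2_offsets mem_Collect_eq
      by (force simp: cross2_offsets)+
    then show "corner_jump u v P \<delta> \<epsilon> (polygon H) = 0"
      by (simp add: corner_jump_def indicator_def)
  qed
qed

lemma has_charge_tri:
  assumes uv: "cross2 u v \<noteq> 0" and c: "c \<noteq> 0"
  shows "has_charge u v (tri u v a b c)
    (\<lambda>P. of_bool (P = a *\<^sub>R u + b *\<^sub>R v) - of_bool (P = (a + c) *\<^sub>R u + b *\<^sub>R v))"
  unfolding has_charge_def
proof
  fix P
  obtain x y where P: "P = x *\<^sub>R u + y *\<^sub>R v" using cross2_basis[OF uv] .
  have pts: "P + \<delta> *\<^sub>R u + \<epsilon> *\<^sub>R v = (x + \<delta>) *\<^sub>R u + (y + \<epsilon>) *\<^sub>R v"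
      "P + \<delta> *\<^sub>R u - \<epsilon> *\<^sub>R v = (x + \<delta>) *\<^sub>R u + (y - \<epsilon>) *\<^sub>R v"
      "P - \<delta> *\<^sub>R u + \<epsilon> *\<^sub>R v = (x - \<delta>) *\<^sub>R u + (y + \<epsilon>) *\<^sub>R v"
      "P - \<delta> *\<^sub>R u - \<epsilon> *\<^sub>R v = (x - \<delta>) *\<^sub>R u + (y - \<epsilon>) *\<^sub>R v" for \<delta> \<epsilon>
    by (simp_all add: P algebra_simps)
  have small: "\<forall>\<^sub>F \<delta> in at_right 0. m \<noteq> 0 \<longrightarrow> \<delta> < \<bar>m\<bar>" for m :: real
    using eventually_at_right_bounded[of m 1] by (cases "m = 0") (auto elim: eventually_mono)
  have pos: "\<forall>\<^sub>F \<delta> in at_right (0::real). 0 < \<delta>" by (rule eventually_at_right_less)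
  \<comment> \<open>The shift \<open>\<delta>\<close> must not jump over \<open>a\<close> or
    \<open>a + c\<close>. The shift \<open>\<epsilon>\<close> must cross neither the line
    \<open>y = b\<close> nor, once \<open>\<delta>\<close> is applied, the line of the third
    side.\<close>
  have "ev2 (\<lambda>\<delta> \<epsilon>. 0 < \<delta> \<and> 0 < \<epsilon> \<and> \<delta> < \<bar>c\<bar> \<and> (x \<noteq> a \<longrightarrow> \<delta> < \<bar>x - a\<bar>) \<and>
      (x \<noteq> a + c \<longrightarrow> \<delta> < \<bar>x - a - c\<bar>) \<and> (y \<noteq> b \<longrightarrow> \<epsilon> < \<bar>y - b\<bar>) \<and>
      \<epsilon> < \<bar>(a + b + c - x - y) + \<delta>\<bar> \<and> \<epsilon> < \<bar>(a + b + c - x - y) - \<delta>\<bar>)"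
  proof -
    have 1: "ev2 (\<lambda>\<delta> \<epsilon>. 0 < \<delta> \<and> \<delta> < \<bar>c\<bar> \<and> (x \<noteq> a \<longrightarrow> \<delta> < \<bar>x - a\<bar>) \<and>
      (x \<noteq> a + c \<longrightarrow> \<delta> < \<bar>x - a - c\<bar>))"
      unfolding ev2_def using pos small[of c] small[of "x - a"] small[of "x - a - c"]
      by eventually_elim (use c in auto)
    have 2: "ev2 (\<lambda>\<delta> \<epsilon>. 0 < \<epsilon> \<and> (y \<noteq> b \<longrightarrow> \<epsilon> < \<bar>y - b\<bar>))"
      unfolding ev2_def using pos small[of "y - b"] by (simp add: eventually_conj_iff)
    have 3: "ev2 (\<lambda>\<delta> \<epsilon>. 0 < \<epsilon> \<and> \<epsilon> * \<bar>1\<bar> < \<bar>a + b + c - x - y + \<delta> * 1\<bar> \<and>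
        \<epsilon> * \<bar>1\<bar> < \<bar>a + b + c - x - y - \<delta> * 1\<bar>)"
      by (rule ev2_bounds) simp
    show ?thesis
      by (rule ev2_mono[OF ev2_conj[OF 1 ev2_conj[OF 2 3]]]) simp
  qed
  then show "ev2 (\<lambda>\<delta> \<epsilon>. corner_jump u v P \<delta> \<epsilon> (tri u v a b c) =
     of_bool (P = a *\<^sub>R u + b *\<^sub>R v) - of_bool (P = (a + c) *\<^sub>R u + b *\<^sub>R v))"
  proof (rule ev2_mono)
    fix \<delta> \<epsilon>
    assume *: "0 < \<delta> \<and> 0 < \<epsilon> \<and> \<delta> < \<bar>c\<bar> \<and> (x \<noteq> a \<longrightarrow> \<delta> < \<bar>x - a\<bar>) \<and>
      (x \<noteq> a + c \<longrightarrow> \<delta> < \<bar>x - a - c\<bar>) \<and> (y \<noteq> b \<longrightarrow> \<epsilon> < \<bar>y - b\<bar>) \<and>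
      \<epsilon> < \<bar>(a + b + c - x - y) + \<delta>\<bar> \<and> \<epsilon> < \<bar>(a + b + c - x - y) - \<delta>\<bar>"
    define I where "I x y = (of_bool (0 \<le> (x - a) * c \<and> 0 \<le> (y - b) * c \<and> 0 \<le> (a + b + c - x - y) * c) :: real)" for x y
    have "corner_jump u v P \<delta> \<epsilon> (tri u v a b c) = 
       I (x + \<delta>) (y + \<epsilon>) - I (x + \<delta>) (y - \<epsilon>) - I (x - \<delta>) (y + \<epsilon>) + I (x - \<delta>) (y - \<epsilon>)"
      unfolding corner_jump_def pts indicator_def I_def mem_tri_iff[OF uv c] ..
    also have "\<dots> = of_bool (x = a \<and> y = b) - of_bool (x = a + c \<and> y = b)"
    proof (cases "c > 0")
      case True
      have I: "I x y = of_bool (a \<le> x \<and> b \<le> y \<and> x + y \<le> a + b + c)" for x y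
        using True unfolding I_def by (auto simp: zero_le_mult_iff)
      show ?thesis
      proof (cases "y = b")
        case True
        \<comment> \<open>On the line \<open>y = b\<close> the points shifted by
          \<open>- \<epsilon>\<close> lie outside, so the jump is the indicator of
          \<open>a \<le> x < a + c\<close> minus that of \<open>a < x \<le> a + c\<close>. Only the
          endpoints survive.\<close>
        have "a \<le> x + \<delta> \<longleftrightarrow> a \<le> x" "a \<le> x - \<delta> \<longleftrightarrow> a < x"
          "(x + \<delta>) + (y + \<epsilon>) \<le> a + b + c \<longleftrightarrow> x < a + c"
          "(x - \<delta>) + (y + \<epsilon>) \<le> a + b + c \<longleftrightarrow> x \<le> a + c"
          using * True by argo+
        then show ?thesis using * \<open>c > 0\<close> True unfolding I by auto
      next
        case False
        \<comment> \<open>Away from \<open>y = b\<close> the shift by \<open>\<epsilon>\<close>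
          changes no inequality, so the terms cancel in pairs.\<close>
        have "b \<le> y + \<epsilon> \<longleftrightarrow> b \<le> y - \<epsilon>"
          "(x + \<delta>) + (y + \<epsilon>) \<le> a + b + c \<longleftrightarrow> (x + \<delta>) + (y - \<epsilon>) \<le> a + b + c"
          "(x - \<delta>) + (y + \<epsilon>) \<le> a + b + c \<longleftrightarrow> (x - \<delta>) + (y - \<epsilon>) \<le> a + b + c"
          using * False by argo+
        then show ?thesis unfolding I using False by simp
      qed
    next
      case False
      then have "c < 0" using c by simp
      have I: "I x y = of_bool (x \<le> a \<and> y \<le> b \<and> a + b + c \<le> x + y)" for x y
        using \<open>c < 0\<close> unfolding I_def by (auto simp: zero_le_mult_iff)
      show ?thesis
      proof (cases "y = b")
        case True
        \<comment> \<open>For negative \<open>c\<close> the triangle lies below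
          \<open>y = b\<close>. Now the points shifted by \<open>+ \<epsilon>\<close> are outside,
          and the reversed side is matched by the opposite sign of the remaining terms.\<close>
        have "x + \<delta> \<le> a \<longleftrightarrow> x < a" "x - \<delta> \<le> a \<longleftrightarrow> x \<le> a"
          "a + b + c \<le> (x + \<delta>) + (y - \<epsilon>) \<longleftrightarrow> a + c \<le> x"
          "a + b + c \<le> (x - \<delta>) + (y - \<epsilon>) \<longleftrightarrow> a + c < x"
          using * True by argo+
        then show ?thesis using * \<open>c < 0\<close> True unfolding I by auto
      next
        case False
        have "y + \<epsilon> \<le> b \<longleftrightarrow> y - \<epsilon> \<le> b"
          "a + b + c \<le> (x + \<delta>) + (y + \<epsilon>) \<longleftrightarrow> a + b + c \<le> (x + \<delta>) + (y - \<epsilon>)"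
          "a + b + c \<le> (x - \<delta>) + (y + \<epsilon>) \<longleftrightarrow> a + b + c \<le> (x - \<delta>) + (y - \<epsilon>)"
          using * False by argo+
        then show ?thesis unfolding I using False by simp
      qed
    qed
    finally show "corner_jump u v P \<delta> \<epsilon> (tri u v a b c) =
     of_bool (P = a *\<^sub>R u + b *\<^sub>R v) - of_bool (P = (a + c) *\<^sub>R u + b *\<^sub>R v)"
      unfolding P cross2_coords_eq_iff[OF uv] .
  qed
qed

section \<open>From charges to sums of edge terms\<close>

text \<open>The charges agree at every point, so they can be tested against any function
  \<open>f\<close> by a sum over their finite support. The factor \<open>m\<close> covers a big
  triangle aligned with the tiles in \<open>\<U>\<close> (\<open>m = 1\<close>) and one that is not
  (\<open>m = 0\<close>).\<close>

lemma edge_sum: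
  assumes til: "tiling T \<D>" and uv: "cross2 u v \<noteq> 0"
    and poly: "\<And>S. S \<in> \<D> \<Longrightarrow> \<exists>H. finite H \<and> S = polygon H \<and> (\<forall>(d, q)\<in>H. d \<noteq> 0)"
    and sub: "\<U> \<subseteq> \<D>"
    and tri: "\<And>S. S \<in> \<U> \<Longrightarrow> c S \<noteq> 0 \<and> S = tri u v (a S) (b S) (c S)"
    and zero: "\<And>S. S \<in> \<D> - \<U> \<Longrightarrow> has_charge u v S (\<lambda>_. 0)"
    and T: "has_charge u v T
      (\<lambda>P. m * (of_bool (P = A *\<^sub>R u + B *\<^sub>R v) - of_bool (P = (A + C) *\<^sub>R u + B *\<^sub>R v)))"
  shows "(\<Sum>S\<in>\<U>. f (a S + c S) (b S) - f (a S) (b S)) = m * (f (A + C) B - f A B)"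
proof -
  have fin: "finite \<D>" using til by (simp add: tiling_def)
  then have finU: "finite \<U>" using sub finite_subset by blast
  define \<kappa> :: "(real \<times> real) set \<Rightarrow> real \<times> real \<Rightarrow> real" where "\<kappa> S P = (if S \<in> \<U> then
      of_bool (P = a S *\<^sub>R u + b S *\<^sub>R v) - of_bool (P = (a S + c S) *\<^sub>R u + b S *\<^sub>R v) else 0)" for S P
  obtain H where H: "\<And>S. S \<in> \<D> \<Longrightarrow> finite (H S) \<and> S = polygon (H S) \<and> (\<forall>(d, q)\<in>H S. d \<noteq> 0)"
    using poly by metis
  have charge: "has_charge u v S (\<kappa> S)" if "S \<in> \<D>" for S
  proof (cases "S \<in> \<U>")
    case True
    then show ?thesis
      using tri[OF True] has_charge_tri[OF uv, of "c S" "a S" "b S"] unfolding \<kappa>_def by simp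
  next
    case False
    then show ?thesis using zero that unfolding \<kappa>_def by simp
  qed
  have pt: "(\<Sum>S\<in>\<U>. of_bool (w = (a S, b S)) - of_bool (w = (a S + c S, b S)))
      = (m * (of_bool (w = (A, B)) - of_bool (w = (A + C, B))) :: real)" for w :: "real \<times> real"
  proof -
    obtain x y where w: "w = (x, y)" by fastforce
    have "(\<Sum>S\<in>\<U>. of_bool (w = (a S, b S)) - of_bool (w = (a S + c S, b S)) :: real)
       = (\<Sum>S\<in>\<U>. \<kappa> S (x *\<^sub>R u + y *\<^sub>R v))"
      by (intro sum.cong refl) (simp add: \<kappa>_def w cross2_coords_eq_iff[OF uv])
    also have "\<dots> = (\<Sum>S\<in>\<D>. \<kappa> S (x *\<^sub>R u + y *\<^sub>R v))"
      using fin sub by (intro sum.mono_neutral_left) (auto simp: \<kappa>_def)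
    also have "\<dots> = m * (of_bool (w = (A, B)) - of_bool (w = (A + C, B)))"
      by (subst tiling_sum_charge[OF til uv H charge T]) (simp_all add: w cross2_coords_eq_iff[OF uv])
    finally show ?thesis .
  qed
  \<comment> \<open>\<open>W\<close> contains every point that carries a charge, so summing over it
    loses nothing.\<close>
  define W where "W = (\<lambda>S. (a S, b S)) ` \<U> \<union> (\<lambda>S. (a S + c S, b S)) ` \<U> \<union> {(A, B), (A + C, B)}"
  define F where "F w = f (fst w) (snd w)" for w
  have finW: "finite W" using finU by (simp add: W_def)
  have pick: "(\<Sum>w\<in>W. F w * (of_bool (w = p) - of_bool (w = q))) = F p - F q"
    if "p \<in> W" "q \<in> W" for p q
  proof -
    have "(\<Sum>w\<in>W. F w * of_bool (w = p)) = F p" if "p \<in> W" for p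
    proof -
      have "(\<Sum>w\<in>W. F w * of_bool (w = p)) = (\<Sum>w\<in>W. if w = p then F w else 0)"
        by (intro sum.cong) auto
      then show ?thesis using finW that by simp
    qed
    then show ?thesis using that by (simp add: right_diff_distrib sum_subtractf)
  qed
  have "(\<Sum>S\<in>\<U>. F (a S, b S) - F (a S + c S, b S))
    = (\<Sum>S\<in>\<U>. \<Sum>w\<in>W. F w * (of_bool (w = (a S, b S)) - of_bool (w = (a S + c S, b S))))"
    by (intro sum.cong refl pick[symmetric]) (auto simp: W_def)
  also have "\<dots> = (\<Sum>w\<in>W. F w * (\<Sum>S\<in>\<U>. of_bool (w = (a S, b S)) - of_bool (w = (a S + c S, b S))))"
    by (subst sum.swap) (simp add: sum_distrib_left)
  also have "\<dots> = m * (\<Sum>w\<in>W. F w * (of_bool (w = (A, B)) - of_bool (w = (A + C, B))))"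
    unfolding pt by (simp add: sum_distrib_left mult.left_commute)
  also have "\<dots> = m * (F (A, B) - F (A + C, B))"
    by (subst pick) (auto simp: W_def)
  finally show ?thesis
    by (simp add: F_def sum_subtractf algebra_simps)
qed

section \<open>Rotation by 60 degrees and equilateral triangles\<close>

text \<open>The last identity is \<omega>*\<omega> = \<omega> - 1 for a primitive sixth root of
  unity \<omega>.\<close>

lemma rot60_simps:
  "rot60 (x + y) = rot60 x + rot60 y" "rot60 (x - y) = rot60 x - rot60 y"
  "rot60 (k *\<^sub>R x) = k *\<^sub>R rot60 x" "rot60 (- x) = - rot60 x"
  "rot60 (rot60 x) = rot60 x - x"
  by (simp_all add: rot60_def prod_eq_iff field_simps)

lemma norm_rot60 [simp]: "norm (rot60 x) = norm x"
  by (simp add: rot60_def norm_prod_def power2_eq_square field_simps)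

lemma rot60_eq_0_iff [simp]: "rot60 x = 0 \<longleftrightarrow> x = 0"
  by (metis norm_eq_zero norm_rot60)

lemma cross2_rot60_self: "cross2 x (rot60 x) = sqrt 3 / 2 * (norm x)\<^sup>2"
  by (simp add: rot60_def cross2_def norm_prod_def power2_eq_square field_simps)

lemma cross2_rot60_self_neq_0: "x \<noteq> 0 \<Longrightarrow> cross2 x (rot60 x) \<noteq> 0"
  by (simp add: cross2_rot60_self)

lemma cross2_commute: "cross2 x y = - cross2 y x"
  by (simp add: cross2_def)

lemma cross2_eq_0E:
  assumes "cross2 x u = 0" "u \<noteq> 0"
  obtains k where "x = k *\<^sub>R u"
proof (cases "fst u = 0")
  case True
  then have "snd u \<noteq> 0" "fst x = 0" using assms by (auto simp: prod_eq_iff cross2_def)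
  then have "x = (snd x / snd u) *\<^sub>R u" using True by (simp add: prod_eq_iff)
  then show ?thesis by (rule that)
next
  case False
  then have "x = (fst x / fst u) *\<^sub>R u"
    using assms(1) by (simp add: prod_eq_iff cross2_def field_simps)
  then show ?thesis by (rule that)
qed

text \<open>Equivalently, the equilateral triangles on \<open>w\<close> and on \<open>u\<close> have a pair of parallel sides.\<close>

definition aligned :: "real \<times> real \<Rightarrow> real \<times> real \<Rightarrow> bool" where
  "aligned w u \<longleftrightarrow> cross2 w u = 0 \<or> cross2 (rot60 w) u = 0 \<or> cross2 (rot60 w - w) u = 0"

text \<open>Rotations preserve determinants, so the rotation can be moved to the first argument. Its
  inverse permutes the three side directions up to sign.\<close>

lemma cross2_rot60_right:
  "cross2 w (rot60 u) = - cross2 (rot60 w - w) u"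
  "cross2 (rot60 w) (rot60 u) = cross2 w u"
  "cross2 (rot60 w - w) (rot60 u) = cross2 (rot60 w) u"
  by (simp_all add: cross2_def rot60_def field_simps)

lemma aligned_rot60: "aligned w (rot60 u) \<longleftrightarrow> aligned w u"
  using cross2_rot60_right[of w u] unfolding aligned_def by auto

lemma aligned_sym: "aligned w u \<longleftrightarrow> aligned u w"
proof -
  have "cross2 (rot60 u) w = cross2 (rot60 w - w) u" "cross2 (rot60 u - u) w = cross2 (rot60 w) u"
    by (simp_all add: cross2_def rot60_def field_simps)
  then show ?thesis
    unfolding aligned_def using cross2_commute[of w u] by auto
qed

text \<open>One side of the triangle on \<open>w\<close> is parallel to \<open>u\<close>. The new
  base corner \<open>q\<close> is the start of that side when the boundary is traversed
  counterclockwise; the other corners are then \<open>q + k *\<^sub>R u\<close> and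
  \<open>q + k *\<^sub>R rot60 u\<close>, for either sign of \<open>k\<close>.\<close>

lemma aligned_tri_vertices:
  assumes "aligned w u" "w \<noteq> 0" "u \<noteq> 0"
  obtains a b c where "c \<noteq> 0" "{p, p + w, p + rot60 w} = tri_vertices u (rot60 u) a b c"
    "norm w = \<bar>c\<bar> * norm u"
proof -
  note found = that
  have base: thesis if q: "{p, p + w, p + rot60 w} = {q, q + k *\<^sub>R u, q + k *\<^sub>R rot60 u}"
    and k: "norm w = \<bar>k\<bar> * norm u" for q k
  proof -
    obtain a b where "q = a *\<^sub>R u + b *\<^sub>R rot60 u"
      using cross2_basis[OF cross2_rot60_self_neq_0[OF assms(3)]] .
    moreover have "k \<noteq> 0" using k assms(2) by auto
    ultimately show thesis
      using found[of k a b] q k by (simp add: tri_vertices_def algebra_simps)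
  qed
  consider "cross2 w u = 0" | "cross2 (rot60 w) u = 0" | "cross2 (rot60 w - w) u = 0"
    using assms(1) by (auto simp: aligned_def)
  then show thesis
  proof cases
    case 1
    then obtain k where k: "w = k *\<^sub>R u" using cross2_eq_0E assms(3) by blast
    then show thesis by (intro base[of p k]) (simp_all add: rot60_simps)
  next
    case 2
    then obtain k where k: "rot60 w = k *\<^sub>R u" using cross2_eq_0E assms(3) by blast
    have n: "norm w = \<bar>- k\<bar> * norm u" using norm_rot60[of w] unfolding k by simp
    have "rot60 w - w = k *\<^sub>R rot60 u" using k rot60_simps(3,5) by metis
    then have "p + rot60 w + (- k) *\<^sub>R rot60 u = p + w" by (simp add: algebra_simps)
    moreover have "p + rot60 w + (- k) *\<^sub>R u = p" using k by simp
    ultimately show thesis using n by (intro base[of "p + rot60 w" "- k"]) auto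
  next
    case 3
    then obtain k where k: "rot60 w - w = k *\<^sub>R u" using cross2_eq_0E assms(3) by blast
    have n: "norm w = \<bar>k\<bar> * norm u" using norm_rot60[of "rot60 w"] rot60_simps(5)[of w] k by simp
    have "rot60 (rot60 w - w) = - w" by (simp add: rot60_simps)
    then have "- w = k *\<^sub>R rot60 u" using k rot60_simps(3) by metis
    then have "p + w + k *\<^sub>R rot60 u = p" by (simp flip: \<open>- w = k *\<^sub>R rot60 u\<close>)
    moreover have "p + w + k *\<^sub>R u = p + rot60 w" using k by (simp add: algebra_simps)
    ultimately show thesis using n by (intro base[of "p + w" k]) auto
  qed
qed

lemma not_aligned_has_charge:
  assumes "\<not> aligned w u" "w \<noteq> 0" "c \<noteq> 0"
  shows "has_charge u v (tri w (rot60 w) a b c) (\<lambda>_. 0)"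
proof -
  have nz: "c * cross2 w (rot60 w) \<noteq> 0"
    using assms cross2_rot60_self_neq_0 by simp
  have scale: "cross2 (k *\<^sub>R d) u = k * cross2 d u" "cross2 (- d) u = - cross2 d u" for k d
    by (simp_all add: cross2_def algebra_simps)
  show ?thesis
    unfolding tri_eq_polygon[OF cross2_rot60_self_neq_0[OF assms(2)] assms(3)]
    by (rule has_charge_polygon_zero) (use assms(1) nz in \<open>auto simp: aligned_def scale\<close>)
qed

lemma tri_polygon:
  assumes "w \<noteq> 0" "c \<noteq> 0"
  shows "\<exists>H. finite H \<and> tri w (rot60 w) a b c = polygon H \<and> (\<forall>(d, q)\<in>H. d \<noteq> 0)"
proof -
  have "w \<noteq> rot60 w" using cross2_rot60_self_neq_0[OF assms(1)] by (auto simp: cross2_def)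
  then show ?thesis
    unfolding tri_eq_polygon[OF cross2_rot60_self_neq_0[OF assms(1)] assms(2)]
    using assms cross2_rot60_self_neq_0[OF assms(1)] by (intro exI conjI) auto
qed

text \<open>Equal sides fix the dot product of two edge vectors as half the squared side, and
  Lagrange's identity then fixes their determinant up to sign. Exchanging two vertices makes the
  sign positive.\<close>

lemma equilateral_triangle_rot60:
  assumes "equilateral_triangle V s S"
  obtains p w where "w \<noteq> 0" "norm w = s" "V = {p, p + w, p + rot60 w}"
proof -
  obtain x y z where V: "V = {x, y, z}" and ne: "x \<noteq> y" "y \<noteq> z" "x \<noteq> z"
    using assms unfolding equilateral_triangle_def card_3_iff by blast
  have s: "s > 0" and d: "dist x y = s" "dist x z = s" "dist y z = s"
    using assms V ne unfolding equilateral_triangle_def by auto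
  define a b c d where "a = fst y - fst x" and "b = snd y - snd x"
    and "c = fst z - fst x" and "d = snd z - snd x"
  have sq: "a\<^sup>2 + b\<^sup>2 = s\<^sup>2" "c\<^sup>2 + d\<^sup>2 = s\<^sup>2" "(c - a)\<^sup>2 + (d - b)\<^sup>2 = s\<^sup>2"
    using d by (auto simp: dist_norm norm_prod_def a_def b_def c_def d_def power2_commute)
  have dot: "a * c + b * d = s\<^sup>2 / 2"
    using sq by (simp add: power2_eq_square algebra_simps)
  have "(a * d - b * c)\<^sup>2 + (a * c + b * d)\<^sup>2 = (a\<^sup>2 + b\<^sup>2) * (c\<^sup>2 + d\<^sup>2)"
    by (simp add: power2_eq_square algebra_simps)
  then have "(a * d - b * c)\<^sup>2 = (sqrt 3 / 2 * s\<^sup>2)\<^sup>2"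
    unfolding dot sq by (simp add: power2_eq_square algebra_simps)
  then consider "a * d - b * c = sqrt 3 / 2 * s\<^sup>2" | "b * c - a * d = sqrt 3 / 2 * s\<^sup>2"
    unfolding power2_eq_iff by fastforce
  then show thesis
  proof cases
    case 1
    \<comment> \<open>A vector is recovered from its dot product and determinant with a given
      nonzero vector.\<close>
    have "s\<^sup>2 * c = a * (a * c + b * d) - b * (a * d - b * c)"
      "s\<^sup>2 * d = b * (a * c + b * d) + a * (a * d - b * c)"
      unfolding sq(1)[symmetric] by (simp_all add: power2_eq_square algebra_simps)
    then have "s\<^sup>2 * c = s\<^sup>2 * (a / 2 - sqrt 3 / 2 * b)" "s\<^sup>2 * d = s\<^sup>2 * (sqrt 3 / 2 * a + b / 2)"
      unfolding dot 1 by (simp_all add: algebra_simps)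
    then have "c = a / 2 - sqrt 3 / 2 * b" "d = sqrt 3 / 2 * a + b / 2" using s by simp_all
    then have "z - x = rot60 (y - x)"
      by (simp add: rot60_def prod_eq_iff a_def b_def c_def d_def)
    then have "z = x + rot60 (y - x)" by (simp add: algebra_simps)
    then show thesis
      using that[of "y - x" x] V ne d by (simp add: dist_norm norm_minus_commute)
  next
    case 2
    have "s\<^sup>2 * a = c * (a * c + b * d) - d * (b * c - a * d)"
      "s\<^sup>2 * b = d * (a * c + b * d) + c * (b * c - a * d)"
      unfolding sq(2)[symmetric] by (simp_all add: power2_eq_square algebra_simps)
    then have "s\<^sup>2 * a = s\<^sup>2 * (c / 2 - sqrt 3 / 2 * d)" "s\<^sup>2 * b = s\<^sup>2 * (sqrt 3 / 2 * c + d / 2)"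
      unfolding dot 2 by (simp_all add: algebra_simps)
    then have "a = c / 2 - sqrt 3 / 2 * d" "b = sqrt 3 / 2 * c + d / 2" using s by simp_all
    then have "y - x = rot60 (z - x)"
      by (simp add: rot60_def prod_eq_iff a_def b_def c_def d_def)
    then have "y = x + rot60 (z - x)" by (simp add: algebra_simps)
    then show thesis
      using that[of "z - x" x] V ne d by (simp add: dist_norm norm_minus_commute insert_commute)
  qed
qed

lemma equilateral_triangle_tri:
  assumes "equilateral_triangle V s S"
  obtains w a b where "w \<noteq> 0" "norm w = s" "V = tri_vertices w (rot60 w) a b 1" "S = tri w (rot60 w) a b 1"
proof -
  obtain p w where w: "w \<noteq> 0" "norm w = s" "V = {p, p + w, p + rot60 w}"
    using equilateral_triangle_rot60[OF assms] .
  obtain a b where "p = a *\<^sub>R w + b *\<^sub>R rot60 w"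
    using cross2_basis[OF cross2_rot60_self_neq_0[OF w(1)]] .
  then have "V = tri_vertices w (rot60 w) a b 1"
    using w(3) by (simp add: tri_vertices_def algebra_simps)
  then show thesis
    using that w assms by (simp add: equilateral_triangle_def tri_def)
qed

section \<open>Edge sums for equilateral tilings and alignment of the tiles\<close>

text \<open>The second sum is the first with the basis vectors exchanged, which by
  \<open>tri_swap\<close> describes the same triangles.\<close>

lemma equilateral_tiling_edge_sums:
  fixes f :: "real \<Rightarrow> real \<Rightarrow> real"
  assumes til: "tiling T \<D>" and eq: "\<forall>S\<in>\<D>. \<exists>V s. equilateral_triangle V s S"
    and u: "u \<noteq> 0" and sub: "\<U> \<subseteq> \<D>"
    and tri: "\<And>S. S \<in> \<U> \<Longrightarrow> c S \<noteq> 0 \<and> S = tri u (rot60 u) (a S) (b S) (c S)"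
    and zero: "\<And>S v. S \<in> \<D> - \<U> \<Longrightarrow>
      has_charge u v S (\<lambda>_. 0) \<and> has_charge (rot60 u) v S (\<lambda>_. 0)"
    and T: "has_charge u (rot60 u) T (\<lambda>P. m * (of_bool (P = A *\<^sub>R u + B *\<^sub>R rot60 u)
        - of_bool (P = (A + C) *\<^sub>R u + B *\<^sub>R rot60 u)))"
      "has_charge (rot60 u) u T (\<lambda>P. m * (of_bool (P = B *\<^sub>R rot60 u + A *\<^sub>R u)
        - of_bool (P = (B + C) *\<^sub>R rot60 u + A *\<^sub>R u)))"
  shows "(\<Sum>S\<in>\<U>. f (a S + c S) (b S) - f (a S) (b S)) = m * (f (A + C) B - f A B)"
    and "(\<Sum>S\<in>\<U>. f (a S) (b S + c S) - f (a S) (b S)) = m * (f A (B + C) - f A B)"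
proof -
  have poly: "\<exists>H. finite H \<and> S = polygon H \<and> (\<forall>(d, q)\<in>H. d \<noteq> 0)" if "S \<in> \<D>" for S
  proof -
    obtain V s where "equilateral_triangle V s S" using eq \<open>S \<in> \<D>\<close> by blast
    then obtain w a b where "w \<noteq> 0" "S = tri w (rot60 w) a b 1"
      by (rule equilateral_triangle_tri)
    then show ?thesis using tri_polygon[of w 1 a b] by simp
  qed
  have uv: "cross2 u (rot60 u) \<noteq> 0" using u by (rule cross2_rot60_self_neq_0)
  then have vu: "cross2 (rot60 u) u \<noteq> 0" using cross2_commute[of u "rot60 u"] by simp
  show "(\<Sum>S\<in>\<U>. f (a S + c S) (b S) - f (a S) (b S)) = m * (f (A + C) B - f A B)"
    by (rule edge_sum[OF til uv poly sub tri _ T(1)]) (use zero in auto)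
  show "(\<Sum>S\<in>\<U>. f (a S) (b S + c S) - f (a S) (b S)) = m * (f A (B + C) - f A B)"
    by (rule edge_sum[OF til vu poly sub _ _ T(2), of c b a "\<lambda>x y. f y x"])
      (use zero tri tri_swap in auto)
qed

text \<open>A tile that is not aligned with the big triangle is excluded by area: the total area of the
  tiles in its alignment class is a sum of edge terms of these tiles, to which the big triangle
  contributes nothing.\<close>

lemma equilateral_tiling_aligned:
  assumes til: "tiling (tri e (rot60 e) A B C) \<D>"
    and eq: "\<forall>S\<in>\<D>. \<exists>V s. equilateral_triangle V s S"
    and e: "e \<noteq> 0" "C \<noteq> 0" and w: "w \<noteq> 0" "tri w (rot60 w) a0 b0 1 \<in> \<D>"
  shows "aligned w e"
proof (rule ccontr)
  assume "\<not> aligned w e"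
  then have na: "\<not> aligned e w" by (simp add: aligned_sym)
  let ?v = "rot60 w"
  define \<U> where "\<U> = {S \<in> \<D>. \<exists>a b c. c \<noteq> 0 \<and> S = tri w ?v a b c}"
  then have "\<forall>S\<in>\<U>. \<exists>a b c. c \<noteq> 0 \<and> S = tri w ?v a b c" by blast
  then obtain a b c where abc: "\<And>S. S \<in> \<U> \<Longrightarrow> c S \<noteq> 0 \<and> S = tri w ?v (a S) (b S) (c S)"
    by metis
  have sub: "\<U> \<subseteq> \<D>" by (auto simp: \<U>_def)
  have zero: "has_charge w v S (\<lambda>_. 0) \<and> has_charge ?v v S (\<lambda>_. 0)" if "S \<in> \<D> - \<U>" for S v
  proof -
    obtain V s where "equilateral_triangle V s S" using eq \<open>S \<in> \<D> - \<U>\<close> by blast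
    then obtain z x y where z: "z \<noteq> 0" "V = tri_vertices z (rot60 z) x y 1" "S = tri z (rot60 z) x y 1"
      by (rule equilateral_triangle_tri)
    have "\<not> aligned z w"
    proof
      assume "aligned z w"
      then obtain a b c where "c \<noteq> 0"
        "{x *\<^sub>R z + y *\<^sub>R rot60 z, x *\<^sub>R z + y *\<^sub>R rot60 z + z, x *\<^sub>R z + y *\<^sub>R rot60 z + rot60 z}
          = tri_vertices w ?v a b c"
        using aligned_tri_vertices z(1) w(1) by metis
      moreover have "tri_vertices z (rot60 z) x y 1 =
        {x *\<^sub>R z + y *\<^sub>R rot60 z, x *\<^sub>R z + y *\<^sub>R rot60 z + z, x *\<^sub>R z + y *\<^sub>R rot60 z + rot60 z}"
        by (simp add: tri_vertices_def algebra_simps)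
      ultimately have "S = tri w ?v a b c" using z(3) by (simp add: tri_def)
      then show False using that \<open>c \<noteq> 0\<close> by (auto simp: \<U>_def)
    qed
    then show ?thesis
      using not_aligned_has_charge[of z w 1] not_aligned_has_charge[of z ?v 1] z(1,3)
      by (simp add: aligned_rot60)
  qed
  \<comment> \<open>The zero charge is written as a multiple with factor \<open>0\<close> to match
    the form with \<open>m = 0\<close>.\<close>
  have T: "has_charge w v (tri e (rot60 e) A B C) (\<lambda>P. 0 * x P)"
    "has_charge ?v v (tri e (rot60 e) A B C) (\<lambda>P. 0 * x P)" for v x
    using not_aligned_has_charge[of e w C] not_aligned_has_charge[of e ?v C] na e
    by (simp_all add: aligned_rot60)
  note sums = equilateral_tiling_edge_sums[OF til eq w(1) sub abc zero T]
  \<comment> \<open>Up to a constant factor \<open>(c S)\<^sup>2\<close> is the area. The first part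
    is a difference along a side parallel to \<open>w\<close>, the second along a side parallel to
    \<open>?v\<close>, so both sums vanish.\<close>
  have "(\<Sum>S\<in>\<U>. (c S)\<^sup>2) = (\<Sum>S\<in>\<U>. ((a S + c S)\<^sup>2 - (a S)\<^sup>2) - 2 * (a S * (b S + c S) - a S * b S))"
    by (intro sum.cong refl) (simp add: power2_eq_square algebra_simps)
  also have "\<dots> = 0"
    unfolding sum_subtractf[of "\<lambda>S. (a S + c S)\<^sup>2 - (a S)\<^sup>2"] sum_distrib_left[symmetric]
    using sums(1)[of "\<lambda>x y. x\<^sup>2"] sums(2)[of "\<lambda>x y. x * y"] by simp
  finally have "\<forall>S\<in>\<U>. (c S)\<^sup>2 = 0"
    using til sub finite_subset by (subst (asm) sum_nonneg_eq_0_iff) (auto simp: tiling_def)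
  moreover have "tri w ?v a0 b0 1 \<in> \<U>"
    unfolding \<U>_def using w(2)
    by (intro CollectI conjI exI[of _ a0] exI[of _ b0] exI[of _ 1] refl) simp_all
  ultimately show False using abc by (metis zero_eq_power2)
qed

section \<open>Counting shifted grid lines by rounding\<close>

text \<open>Nearest integer, with ties rounded up. It jumps exactly at the half-integers, so its
  increments count shifted lines.\<close>

definition rnd :: "real \<Rightarrow> int" where
  "rnd x = \<lfloor>x + 1 / 2\<rfloor>"

lemma half_integers_between:
  assumes "frac x \<noteq> 1 / 2" "frac y \<noteq> 1 / 2"
  shows "{k::int. x \<le> of_int k + 1 / 2 \<and> of_int k + 1 / 2 \<le> y} = {rnd x..<rnd y}"
proof -
  have ne: "z \<noteq> of_int k + 1 / 2" if "frac z \<noteq> 1 / 2" for z :: real and k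
    using that by (auto simp: frac_def floor_add_int[symmetric] add.commute)
  \<comment> \<open>A tie at \<open>x\<close> would satisfy the left side and yet round up to
    \<open>k + 1\<close>.\<close>
  have "x \<le> of_int k + 1 / 2 \<longleftrightarrow> rnd x \<le> k" for k
    using ne[OF assms(1), of k] unfolding rnd_def by linarith
  moreover have "of_int k + 1 / 2 \<le> y \<longleftrightarrow> k < rnd y" for k
    unfolding rnd_def by linarith
  ultimately show ?thesis by auto
qed

text \<open>For negative \<open>c\<close> the endpoints \<open>x\<close> and \<open>x + c\<close>
  change places, which \<open>sgn c\<close> compensates.\<close>

lemma card_half_integers:
  assumes "frac x \<noteq> 1 / 2" "frac (x + c) \<noteq> 1 / 2" "c \<noteq> 0"
  shows "real_of_int (rnd (x + c) - rnd x) = sgn c *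
    real (card {k::int. 0 \<le> (of_int k + 1 / 2 - x) * c \<and> 0 \<le> (x + c - (of_int k + 1 / 2)) * c})"
proof (cases "c > 0")
  case True
  then have "{k::int. 0 \<le> (of_int k + 1 / 2 - x) * c \<and> 0 \<le> (x + c - (of_int k + 1 / 2)) * c}
    = {rnd x..<rnd (x + c)}"
    unfolding half_integers_between[OF assms(1,2), symmetric] by (simp add: zero_le_mult_iff)
  moreover have "rnd x \<le> rnd (x + c)"
    unfolding rnd_def using True by (intro floor_mono) simp
  ultimately show ?thesis using True by simp
next
  case False
  then have "c < 0" using assms(3) by simp
  then have "{k::int. 0 \<le> (of_int k + 1 / 2 - x) * c \<and> 0 \<le> (x + c - (of_int k + 1 / 2)) * c}
    = {rnd (x + c)..<rnd x}"
    unfolding half_integers_between[OF assms(2,1), symmetric]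
    by (auto simp add: zero_le_mult_iff)
  moreover have "rnd (x + c) \<le> rnd x"
    unfolding rnd_def using \<open>c < 0\<close> by (intro floor_mono) simp
  ultimately show ?thesis using \<open>c < 0\<close> by simp
qed

lemma card_range_Collect:
  assumes "inj f"
  shows "card {L \<in> range f. Q L} = card {k. Q (f k)}"
proof -
  have "{L \<in> range f. Q L} = f ` {k. Q (f k)}" by auto
  then show ?thesis using assms by (simp add: card_image inj_on_subset)
qed

abbreviation (input) "Psi1 \<equiv> Psi (1, 0)"

text \<open>\<open>Psi (0, 1)\<close> is \<open>Psi (1, 0)\<close> rotated by 60 degrees, so
  \<open>Psi\<close>-coordinates are the oblique coordinates used for \<open>tri\<close>.\<close>

lemma Psi_eq: "Psi (a, b) = a *\<^sub>R Psi1 + b *\<^sub>R rot60 Psi1"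
  by (simp add: Psi_def rot60_def)

lemma Psi1_neq_0: "Psi1 \<noteq> 0"
  by (simp add: Psi_def zero_prod_def)

lemma norm_Psi1: "norm Psi1 = 1"
  by (simp add: Psi_def norm_prod_def)

lemma cross2_Psi1: "cross2 Psi1 (rot60 Psi1) \<noteq> 0"
  using cross2_rot60_self_neq_0 Psi1_neq_0 .

lemma inj_Psi: "inj Psi"
  by (auto simp: inj_def Psi_def)

text \<open>The side with first coordinate \<open>a\<close> spans all heights of the triangle, so a
  horizontal line meets the triangle exactly if it meets that side.\<close>

lemma num_lines_horizontal:
  assumes "c \<noteq> 0" "frac b \<noteq> 1 / 2" "frac (b + c) \<noteq> 1 / 2"
  shows "sgn c * real (num_lines_through shifted_horizontal_lines (tri Psi1 (rot60 Psi1) a b c))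
    = real_of_int (rnd (b + c) - rnd b)"
proof -
  let ?l = "\<lambda>k::int. Psi ` (UNIV \<times> {of_int k + 1 / 2})"
  have inj: "inj ?l"
  proof (rule injI)
    fix k l :: int
    assume "?l k = ?l l"
    then have "(UNIV :: real set) \<times> {real_of_int k + 1 / 2} = UNIV \<times> {of_int l + 1 / 2}"
      by (simp add: inj_image_eq_iff[OF inj_Psi])
    then show "k = l" by (auto simp: times_eq_iff)
  qed
  have meet: "?l k \<inter> tri Psi1 (rot60 Psi1) a b c \<noteq> {} \<longleftrightarrow>
    0 \<le> (of_int k + 1 / 2 - b) * c \<and> 0 \<le> (b + c - (of_int k + 1 / 2)) * c" for k
  proof -
    have "?l k \<inter> tri Psi1 (rot60 Psi1) a b c \<noteq> {} \<longleftrightarrow>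
      (\<exists>x. 0 \<le> (x - a) * c \<and> 0 \<le> (of_int k + 1 / 2 - b) * c \<and>
        0 \<le> (a + b + c - x - (of_int k + 1 / 2)) * c)"
      unfolding mem_tri_iff[OF cross2_Psi1 assms(1), symmetric] Psi_eq[symmetric] by auto
    also have "\<dots> \<longleftrightarrow> 0 \<le> (of_int k + 1 / 2 - b) * c \<and> 0 \<le> (b + c - (of_int k + 1 / 2)) * c"
    proof
      assume "\<exists>x. 0 \<le> (x - a) * c \<and> 0 \<le> (of_int k + 1 / 2 - b) * c \<and>
        0 \<le> (a + b + c - x - (of_int k + 1 / 2)) * c"
      then obtain x where x: "0 \<le> (x - a) * c" "0 \<le> (of_int k + 1 / 2 - b) * c"
        "0 \<le> (a + b + c - x - (of_int k + 1 / 2)) * c" by blast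
      have "(b + c - (of_int k + 1 / 2)) * c = (x - a) * c + (a + b + c - x - (of_int k + 1 / 2)) * c"
        by (simp add: algebra_simps)
      then show "0 \<le> (of_int k + 1 / 2 - b) * c \<and> 0 \<le> (b + c - (of_int k + 1 / 2)) * c"
        using x by linarith
    qed (auto intro!: exI[of _ a])
    finally show ?thesis .
  qed
  have "num_lines_through shifted_horizontal_lines (tri Psi1 (rot60 Psi1) a b c)
    = card {k. ?l k \<inter> tri Psi1 (rot60 Psi1) a b c \<noteq> {}}"
    unfolding num_lines_through_def shifted_horizontal_lines_def by (rule card_range_Collect[OF inj])
  then show ?thesis
    unfolding meet card_half_integers[OF assms(2,3,1)] by (simp only:)
qed

text \<open>Here the side with second coordinate \<open>b\<close> supplies the meeting
  point.\<close>

lemma num_lines_diagonal: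
  assumes "c \<noteq> 0" "frac a \<noteq> 1 / 2" "frac (a + c) \<noteq> 1 / 2"
  shows "sgn c * real (num_lines_through shifted_diagonal_lines (tri Psi1 (rot60 Psi1) a b c))
    = real_of_int (rnd (a + c) - rnd a)"
proof -
  let ?l = "\<lambda>k::int. Psi ` ({of_int k + 1 / 2} \<times> UNIV)"
  have inj: "inj ?l"
  proof (rule injI)
    fix k l :: int
    assume "?l k = ?l l"
    then have "{real_of_int k + 1 / 2} \<times> (UNIV :: real set) = {of_int l + 1 / 2} \<times> UNIV"
      by (simp add: inj_image_eq_iff[OF inj_Psi])
    then show "k = l" by (auto simp: times_eq_iff)
  qed
  have meet: "?l k \<inter> tri Psi1 (rot60 Psi1) a b c \<noteq> {} \<longleftrightarrow>
    0 \<le> (of_int k + 1 / 2 - a) * c \<and> 0 \<le> (a + c - (of_int k + 1 / 2)) * c" for k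
  proof -
    have "?l k \<inter> tri Psi1 (rot60 Psi1) a b c \<noteq> {} \<longleftrightarrow>
      (\<exists>y. 0 \<le> (of_int k + 1 / 2 - a) * c \<and> 0 \<le> (y - b) * c \<and>
        0 \<le> (a + b + c - (of_int k + 1 / 2) - y) * c)"
      unfolding mem_tri_iff[OF cross2_Psi1 assms(1), symmetric] Psi_eq[symmetric] by auto
    also have "\<dots> \<longleftrightarrow> 0 \<le> (of_int k + 1 / 2 - a) * c \<and> 0 \<le> (a + c - (of_int k + 1 / 2)) * c"
    proof
      assume "\<exists>y. 0 \<le> (of_int k + 1 / 2 - a) * c \<and> 0 \<le> (y - b) * c \<and>
        0 \<le> (a + b + c - (of_int k + 1 / 2) - y) * c"
      then obtain y where y: "0 \<le> (of_int k + 1 / 2 - a) * c" "0 \<le> (y - b) * c"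
        "0 \<le> (a + b + c - (of_int k + 1 / 2) - y) * c" by blast
      have "(a + c - (of_int k + 1 / 2)) * c = (y - b) * c + (a + b + c - (of_int k + 1 / 2) - y) * c"
        by (simp add: algebra_simps)
      then show "0 \<le> (of_int k + 1 / 2 - a) * c \<and> 0 \<le> (a + c - (of_int k + 1 / 2)) * c"
        using y by linarith
    next
      have eq: "a + b + c - (of_int k + 1 / 2) - b = a + c - (of_int k + 1 / 2)" by simp
      show "\<exists>y. 0 \<le> (of_int k + 1 / 2 - a) * c \<and> 0 \<le> (y - b) * c \<and>
          0 \<le> (a + b + c - (of_int k + 1 / 2) - y) * c"
        if "0 \<le> (of_int k + 1 / 2 - a) * c \<and> 0 \<le> (a + c - (of_int k + 1 / 2)) * c"
        by (rule exI[of _ b], unfold eq) (use that in simp)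
    qed
    finally show ?thesis .
  qed
  have "num_lines_through shifted_diagonal_lines (tri Psi1 (rot60 Psi1) a b c)
    = card {k. ?l k \<inter> tri Psi1 (rot60 Psi1) a b c \<noteq> {}}"
    unfolding num_lines_through_def shifted_diagonal_lines_def by (rule card_range_Collect[OF inj])
  then show ?thesis
    unfolding meet card_half_integers[OF assms(2,3,1)] by (simp only:)
qed

section \<open>Rounding displacements and the sum of squares\<close>

theorem theorem7p2:
  fixes A B C :: real and T :: "(real \<times> real) set" and \<D> :: "(real \<times> real) set set"
  assumes "C \<noteq> 0"
    and "T = convex hull {Psi (A, B), Psi (A + C, B), Psi (A, B + C)}"
    and "tiling T \<D>"
    and "\<forall>S\<in>\<D>. \<exists>V s. equilateral_triangle V s S"
    and "B \<in> \<int>" and "B + C \<in> \<int>"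
    and "\<forall>S\<in>\<D>. \<forall>V s. equilateral_triangle V s S \<longrightarrow>
           (\<forall>a b. Psi (a, b) \<in> V \<longrightarrow> frac a \<noteq> 1/2 \<and> frac b \<noteq> 1/2)"
    and "\<forall>S\<in>\<D>. num_lines_through shifted_diagonal_lines S
                 = num_lines_through shifted_horizontal_lines S"
  shows "\<forall>S\<in>\<D>. \<forall>V s. equilateral_triangle V s S \<longrightarrow>
           s = real (num_lines_through shifted_diagonal_lines S) \<and> s \<in> \<int>"
proof (intro ballI allI impI)
  fix S0 V0 s0
  assume S0: "S0 \<in> \<D>" "equilateral_triangle V0 s0 S0"
  let ?u = Psi1 and ?v = "rot60 Psi1"
  define N where "N S = real (num_lines_through shifted_diagonal_lines S)" for S
  have T: "T = tri ?u ?v A B C"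
    unfolding assms(2) tri_def tri_vertices_def Psi_eq[symmetric] ..
  have rep: "\<exists>a b c. c \<noteq> 0 \<and> V = tri_vertices ?u ?v a b c \<and> \<bar>c\<bar> = s"
    if S: "S \<in> \<D>" "equilateral_triangle V s S" for S V s
  proof -
    obtain w x y where w: "w \<noteq> 0" "norm w = s" "V = tri_vertices w (rot60 w) x y 1"
        "S = tri w (rot60 w) x y 1"
      using equilateral_triangle_tri[OF S(2)] .
    have "aligned w ?u"
      using equilateral_tiling_aligned[OF assms(3)[unfolded T] assms(4) Psi1_neq_0 assms(1) w(1)] S(1) w(4)
      by blast
    then obtain a b c where "c \<noteq> 0" "norm w = \<bar>c\<bar> * norm ?u"
      "{x *\<^sub>R w + y *\<^sub>R rot60 w, x *\<^sub>R w + y *\<^sub>R rot60 w + w, x *\<^sub>R w + y *\<^sub>R rot60 w + rot60 w}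
        = tri_vertices ?u ?v a b c"
      using aligned_tri_vertices w(1) Psi1_neq_0 by metis
    moreover have "V = {x *\<^sub>R w + y *\<^sub>R rot60 w, x *\<^sub>R w + y *\<^sub>R rot60 w + w, x *\<^sub>R w + y *\<^sub>R rot60 w + rot60 w}"
      unfolding w(3) by (simp add: tri_vertices_def algebra_simps)
    ultimately show ?thesis using w(2) norm_Psi1 by auto
  qed
  \<comment> \<open>The clause on \<open>S0\<close> ties the chosen coordinates to the given side
    length \<open>s0\<close>.\<close>
  define Q where "Q S a b c \<longleftrightarrow> c \<noteq> 0 \<and> S = tri ?u ?v a b c \<and> (S = S0 \<longrightarrow> \<bar>c\<bar> = s0) \<and>
    (\<forall>x y. Psi (x, y) \<in> tri_vertices ?u ?v a b c \<longrightarrow> frac x \<noteq> 1/2 \<and> frac y \<noteq> 1/2)" for S a b c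
  have "\<forall>S\<in>\<D>. \<exists>a b c. Q S a b c"
  proof
    fix S assume S: "S \<in> \<D>"
    obtain V s where V: "equilateral_triangle V s S" "S = S0 \<longrightarrow> s = s0"
    proof (cases "S = S0")
      case True
      then show ?thesis using that S0(2) by blast
    next
      case False
      then show ?thesis using that assms(4) S by blast
    qed
    from rep[OF S V(1)] obtain a b c where
      "c \<noteq> 0" "V = tri_vertices ?u ?v a b c" "\<bar>c\<bar> = s" by blast
    moreover have "S = convex hull V" using V(1) by (simp add: equilateral_triangle_def)
    moreover have "\<forall>x y. Psi (x, y) \<in> V \<longrightarrow> frac x \<noteq> 1/2 \<and> frac y \<noteq> 1/2"
      using assms(7) S V(1) by blast
    ultimately show "\<exists>a b c. Q S a b c"
      using V(2) unfolding Q_def tri_def by (intro exI[of _ a] exI[of _ b] exI[of _ c]) simp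
  qed
  then obtain a b c where Q: "\<forall>S\<in>\<D>. Q S (a S) (b S) (c S)" by metis
  have abc: "c S \<noteq> 0 \<and> S = tri ?u ?v (a S) (b S) (c S)" if "S \<in> \<D>" for S
    using bspec[OF Q that] unfolding Q_def by (elim conjE) (intro conjI)
  have c0: "\<bar>c S0\<bar> = s0"
    using bspec[OF Q S0(1)] unfolding Q_def by (elim conjE) (erule mp, rule refl)
  have half: "frac x \<noteq> 1/2 \<and> frac y \<noteq> 1/2"
    if "S \<in> \<D>" "Psi (x, y) \<in> tri_vertices ?u ?v (a S) (b S) (c S)" for S x y
    by (rule bspec[OF Q that(1), unfolded Q_def, THEN conjunct2, THEN conjunct2, THEN conjunct2,
          rule_format, OF that(2)])
  have vu: "cross2 ?v ?u \<noteq> 0" using cross2_Psi1 cross2_commute[of ?u ?v] by argo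
  have chT: "has_charge ?u ?v T (\<lambda>P. 1 * (of_bool (P = A *\<^sub>R ?u + B *\<^sub>R ?v)
        - of_bool (P = (A + C) *\<^sub>R ?u + B *\<^sub>R ?v)))"
      "has_charge ?v ?u T (\<lambda>P. 1 * (of_bool (P = B *\<^sub>R ?v + A *\<^sub>R ?u)
        - of_bool (P = (B + C) *\<^sub>R ?v + A *\<^sub>R ?u)))"
    using has_charge_tri[OF cross2_Psi1 assms(1), of A B] has_charge_tri[OF vu assms(1), of B A]
    unfolding T tri_swap[of ?v] by (simp_all only: mult_1)
  \<comment> \<open>All tiles are aligned with \<open>T\<close>, so the class of tiles used for the
    edge sums is all of \<open>\<D>\<close>.\<close>
  have zero: "has_charge ?u v S (\<lambda>_. 0) \<and> has_charge ?v v S (\<lambda>_. 0)" if "S \<in> \<D> - \<D>" for S v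
    using that by simp
  have sums: "(\<Sum>S\<in>\<D>. f (a S + c S) (b S) - f (a S) (b S)) = f (A + C) B - f A B"
    "(\<Sum>S\<in>\<D>. f (a S) (b S + c S) - f (a S) (b S)) = f A (B + C) - f A B"
    for f :: "real \<Rightarrow> real \<Rightarrow> real"
    using equilateral_tiling_edge_sums[OF assms(3,4) Psi1_neq_0 subset_refl abc zero chT, of f]
    unfolding mult_1 by simp_all
  define r where "r x = real_of_int (rnd x) - x" for x
  have r0: "r x = 0" if "x \<in> \<int>" for x
  proof -
    obtain k where "x = of_int k" using \<open>x \<in> \<int>\<close> Ints_cases by blast
    moreover have "\<lfloor>real_of_int k + 1 / 2\<rfloor> = k" by linarith
    ultimately show ?thesis by (simp add: r_def rnd_def)
  qed
  have rB: "r B = 0" "r (B + C) = 0" using r0 assms(5,6) by auto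
  have step: "r (a S + c S) - r (a S) = sgn (c S) * N S - c S"
    "r (b S + c S) - r (b S) = sgn (c S) * N S - c S" if S: "S \<in> \<D>" for S
  proof -
    have "Psi (a S, b S) \<in> tri_vertices ?u ?v (a S) (b S) (c S)"
      "Psi (a S + c S, b S) \<in> tri_vertices ?u ?v (a S) (b S) (c S)"
      "Psi (a S, b S + c S) \<in> tri_vertices ?u ?v (a S) (b S) (c S)"
      unfolding tri_vertices_def Psi_eq[symmetric] by auto
    then have "frac (a S) \<noteq> 1/2" "frac (b S) \<noteq> 1/2" "frac (a S + c S) \<noteq> 1/2" "frac (b S + c S) \<noteq> 1/2"
      using half[OF S] by blast+
    then have "sgn (c S) * N S = real_of_int (rnd (a S + c S) - rnd (a S))"
      "sgn (c S) * N S = real_of_int (rnd (b S + c S) - rnd (b S))"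
      using num_lines_diagonal[of "c S" "a S" "b S"] num_lines_horizontal[of "c S" "b S" "a S"]
        abc[OF S] assms(8) S by (simp_all add: N_def)
    then show "r (a S + c S) - r (a S) = sgn (c S) * N S - c S"
      "r (b S + c S) - r (b S) = sgn (c S) * N S - c S"
      by (simp_all add: r_def)
  qed
  \<comment> \<open>By \<open>step\<close> the increments of \<open>r\<close> along the two sides of
    each tile agree. Their sums over all tiles therefore agree too, which transfers integrality of
    the height of \<open>T\<close> to its diagonal coordinates.\<close>
  have "r (A + C) - r A = (\<Sum>S\<in>\<D>. r (b S + c S) - r (b S))"
    using sums(1)[of "\<lambda>x y. r x"] step by simp
  also have "\<dots> = 0"
    using sums(2)[of "\<lambda>x y. r y"] rB by simp
  finally have rA: "r (A + C) = r A" by simp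
  have "(\<Sum>S\<in>\<D>. (sgn (c S) * N S - c S)\<^sup>2) = (\<Sum>S\<in>\<D>. ((r (a S + c S))\<^sup>2 - (r (a S))\<^sup>2)
      - 2 * (r (a S) * r (b S + c S) - r (a S) * r (b S)))"
  proof (intro sum.cong refl)
    fix S assume S: "S \<in> \<D>"
    have "r (a S + c S) = r (a S) + (sgn (c S) * N S - c S)"
      "r (b S + c S) = r (b S) + (sgn (c S) * N S - c S)" using step[OF S] by simp_all
    \<comment> \<open>With \<open>x = r (a S)\<close> and \<open>y = r (b S)\<close>, the mixed term
      is a difference along the side on which the first coordinate stays \<open>a S\<close>, hence
      an edge term.\<close>
    moreover have "d\<^sup>2 = (x + d)\<^sup>2 - x\<^sup>2 - 2 * (x * (y + d) - x * y)" for x y d :: real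
      by (simp add: power2_eq_square algebra_simps)
    ultimately show "(sgn (c S) * N S - c S)\<^sup>2 = ((r (a S + c S))\<^sup>2 - (r (a S))\<^sup>2)
      - 2 * (r (a S) * r (b S + c S) - r (a S) * r (b S))"
      by (simp only:)
  qed
  \<comment> \<open>For \<open>T\<close> the difference of squares vanishes by \<open>rA\<close>,
    the mixed term by \<open>rB\<close>.\<close>
  also have "\<dots> = 0"
    unfolding sum_subtractf[of "\<lambda>S. (r (a S + c S))\<^sup>2 - (r (a S))\<^sup>2"] sum_distrib_left[symmetric]
    using sums(1)[of "\<lambda>x y. (r x)\<^sup>2"] sums(2)[of "\<lambda>x y. r x * r y"] rA rB by simp
  finally have "(sgn (c S0) * N S0 - c S0)\<^sup>2 = 0"
    using assms(3) S0(1) by (subst (asm) sum_nonneg_eq_0_iff) (auto simp: tiling_def)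
  then have "c S0 = sgn (c S0) * N S0" by simp
  then have "\<bar>c S0\<bar> = \<bar>sgn (c S0)\<bar> * N S0"
    by (metis N_def abs_mult abs_of_nat)
  then have "\<bar>c S0\<bar> = N S0"
    using abc[OF S0(1)] by (simp add: abs_sgn_eq)
  then show "s0 = real (num_lines_through shifted_diagonal_lines S0) \<and> s0 \<in> \<int>"
    using c0 by (auto simp: N_def)
qed

end
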